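(* Let $k\ge1$, let $\Lambda$ be a row-finite and cofinal $k$-graph with no sources, and suppose that $\ell\colon\Lambda^0\to\mathbb{Z}$ satisfies $\ell(s(\lambda))=1+\ell(r(\lambda))$ for all $i\in\{1,\dots,k\}$ and all $\lambda\in\Lambda^{e_i}$. Suppose that for all $w,v\in\Lambda^0$ and all $i\neq j$ in $\{1,\dots,k\}$ we have $|w\Lambda^{e_i}v|=|w\Lambda^{e_j}v|$. Then $S(\Lambda)$ is stably finite.
   Context: $\mathbb{N}=\{0,1,2,\dots\}$, and $e_1,\dots,e_k$ are the standard generators of $\mathbb{N}^k$. A $k$-graph is a nonempty countable small category $\Lambda$ with a functor $d\colon\Lambda\to\mathbb{N}^k$ such that whenever $d(\lambda)=m+n$ there are unique $\mu,\nu\in\Lambda$ with $d(\mu)=m$, $d(\nu)=n$, $\lambda=\mu\nu$. $\Lambda^n=d^{-1}(n)$; $\Lambda^0$ is the set of vertices (identity morphisms); $r(\lambda),s(\lambda)\in\Lambda^0$ are the codomain and domain of $\lambda$. For $v,w\in\Lambda^0$: $v\Lambda=\{\lambda:r(\lambda)=v\}$, $v\Lambda^n=v\Lambda\cap\Lambda^n$, $v\Lambda^nw=\{\lambda\in v\Lambda^n:s(\lambda)=w\}$. $\Lambda$ is row-finite if every $v\Lambda^n$ is finite, has no sources if every $v\Lambda^n$ is nonempty, and is cofinal if for all $v,w\in\Lambda^0$ there is $n\in\mathbb{N}^k$ with $s(w\Lambda^n)\subseteq s(v\Lambda)$. The semigroup $S(\Lambda)$: let $\mathbb{N}\Lambda^0$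 be the finitely supported functions $\Lambda^0\to\mathbb{N}$ with generators $\delta_v$, and for $n\in\mathbb{N}^k$ let $A_n^t\colon\mathbb{N}\Lambda^0\to\mathbb{N}\Lambda^0$ be the additive map $A_n^t\delta_v=\sum_{\lambda\in v\Lambda^n}\delta_{s(\lambda)}$. Write $x\sim_\Lambda y$ if $A_p^tx=A_q^ty$ for some $p,q\in\mathbb{N}^k$. Write $f\approx_\Lambda g$ if there are finitely many $x_i,y_i\in\mathbb{N}\Lambda^0$ with $f\sim_\Lambda\sum_ix_i$, $g\sim_\Lambda\sum_iy_i$ and $x_i\sim_\Lambda y_i$ for all $i$. Then $\approx_\Lambda$ is an equivalence relation and $S(\Lambda)=\mathbb{N}\Lambda^0/\!\approx_\Lambda$ is an abelian semigroup with identity under $[f]_\Lambda+[g]_\Lambda=[f+g]_\Lambda$. In an abelian semigroup $S$ with identity, a nonzero $x$ is infinite if $x+y=x$ for some nonzero $y\in S$; $S$ is stably finite if it has no infinite elements. *)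

theory Defs
  imports
    "HOL-Analysis.Finite_Cartesian_Product"
    "HOL-Library.Multiset"
    "HOL-Library.Countable_Set"
    "HOL-Algebra.Group"
begin

text \<open>
  The index set of the generators of \<open>\<nat>\<^sup>k\<close> is a finite type \<open>'k\<close> (so \<open>k = CARD('k) \<ge> 1\<close>);
  the generator \<open>e\<^sub>i\<close> is \<open>axis i 1\<close>.  A small category is given by its set of morphisms alone:
  an object is identified with its identity morphism, so that \<open>src\<close> (domain) and \<open>rng\<close> (codomain)
  take values in the morphisms.  The composite \<open>cmp \<Lambda> \<mu> \<nu>\<close> is meaningful when \<open>src \<mu> = rng \<nu>\<close>.
\<close>

record ('a, 'k::finite) graded_cat =
  mor :: "'a set"
  rng :: "'a \<Rightarrow> 'a"
  src :: "'a \<Rightarrow> 'a"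
  cmp :: "'a \<Rightarrow> 'a \<Rightarrow> 'a"
  deg :: "'a \<Rightarrow> nat ^ 'k"

locale k_graph =
  fixes \<Lambda> :: "('a, 'k::finite) graded_cat"
  assumes nonempty: "mor \<Lambda> \<noteq> {}"
    and countable_mor: "countable (mor \<Lambda>)"
    and rng_closed: "\<kappa> \<in> mor \<Lambda> \<Longrightarrow> rng \<Lambda> \<kappa> \<in> mor \<Lambda>"
    and src_closed: "\<kappa> \<in> mor \<Lambda> \<Longrightarrow> src \<Lambda> \<kappa> \<in> mor \<Lambda>"
    and rng_rng: "\<kappa> \<in> mor \<Lambda> \<Longrightarrow> rng \<Lambda> (rng \<Lambda> \<kappa>) = rng \<Lambda> \<kappa>"
    and src_rng: "\<kappa> \<in> mor \<Lambda> \<Longrightarrow> src \<Lambda> (rng \<Lambda> \<kappa>) = rng \<Lambda> \<kappa>"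
    and rng_src: "\<kappa> \<in> mor \<Lambda> \<Longrightarrow> rng \<Lambda> (src \<Lambda> \<kappa>) = src \<Lambda> \<kappa>"
    and src_src: "\<kappa> \<in> mor \<Lambda> \<Longrightarrow> src \<Lambda> (src \<Lambda> \<kappa>) = src \<Lambda> \<kappa>"
    and cmp_closed: "\<lbrakk>\<mu> \<in> mor \<Lambda>; \<nu> \<in> mor \<Lambda>; src \<Lambda> \<mu> = rng \<Lambda> \<nu>\<rbrakk> \<Longrightarrow> cmp \<Lambda> \<mu> \<nu> \<in> mor \<Lambda>"
    and rng_cmp: "\<lbrakk>\<mu> \<in> mor \<Lambda>; \<nu> \<in> mor \<Lambda>; src \<Lambda> \<mu> = rng \<Lambda> \<nu>\<rbrakk> \<Longrightarrow> rng \<Lambda> (cmp \<Lambda> \<mu> \<nu>) = rng \<Lambda> \<mu>"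
    and src_cmp: "\<lbrakk>\<mu> \<in> mor \<Lambda>; \<nu> \<in> mor \<Lambda>; src \<Lambda> \<mu> = rng \<Lambda> \<nu>\<rbrakk> \<Longrightarrow> src \<Lambda> (cmp \<Lambda> \<mu> \<nu>) = src \<Lambda> \<nu>"
    and cmp_assoc: "\<lbrakk>\<mu> \<in> mor \<Lambda>; \<nu> \<in> mor \<Lambda>; \<rho> \<in> mor \<Lambda>; src \<Lambda> \<mu> = rng \<Lambda> \<nu>; src \<Lambda> \<nu> = rng \<Lambda> \<rho>\<rbrakk>
      \<Longrightarrow> cmp \<Lambda> (cmp \<Lambda> \<mu> \<nu>) \<rho> = cmp \<Lambda> \<mu> (cmp \<Lambda> \<nu> \<rho>)"
    and cmp_rng: "\<kappa> \<in> mor \<Lambda> \<Longrightarrow> cmp \<Lambda> (rng \<Lambda> \<kappa>) \<kappa> = \<kappa>"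
    and cmp_src: "\<kappa> \<in> mor \<Lambda> \<Longrightarrow> cmp \<Lambda> \<kappa> (src \<Lambda> \<kappa>) = \<kappa>"
    and deg_rng: "\<kappa> \<in> mor \<Lambda> \<Longrightarrow> deg \<Lambda> (rng \<Lambda> \<kappa>) = 0"
    and deg_src: "\<kappa> \<in> mor \<Lambda> \<Longrightarrow> deg \<Lambda> (src \<Lambda> \<kappa>) = 0"
    and deg_cmp: "\<lbrakk>\<mu> \<in> mor \<Lambda>; \<nu> \<in> mor \<Lambda>; src \<Lambda> \<mu> = rng \<Lambda> \<nu>\<rbrakk>
      \<Longrightarrow> deg \<Lambda> (cmp \<Lambda> \<mu> \<nu>) = deg \<Lambda> \<mu> + deg \<Lambda> \<nu>"
    and factorization: "\<lbrakk>\<kappa> \<in> mor \<Lambda>; deg \<Lambda> \<kappa> = m + n\<rbrakk>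
      \<Longrightarrow> \<exists>!(\<mu>, \<nu>). \<mu> \<in> mor \<Lambda> \<and> \<nu> \<in> mor \<Lambda> \<and> deg \<Lambda> \<mu> = m \<and> deg \<Lambda> \<nu> = n
            \<and> src \<Lambda> \<mu> = rng \<Lambda> \<nu> \<and> \<kappa> = cmp \<Lambda> \<mu> \<nu>"

definition mor_deg :: "('a, 'k::finite) graded_cat \<Rightarrow> nat ^ 'k \<Rightarrow> 'a set" where
  "mor_deg \<Lambda> n = {\<kappa> \<in> mor \<Lambda>. deg \<Lambda> \<kappa> = n}"

definition verts :: "('a, 'k::finite) graded_cat \<Rightarrow> 'a set" where
  "verts \<Lambda> = mor_deg \<Lambda> 0"

lemma (in k_graph) verts_eq_identities: "verts \<Lambda> = {v \<in> mor \<Lambda>. rng \<Lambda> v = v \<and> src \<Lambda> v = v}"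
proof -
  have "rng \<Lambda> v = v \<and> src \<Lambda> v = v" if v: "v \<in> mor \<Lambda>" "deg \<Lambda> v = 0" for v
  proof -
    have "deg \<Lambda> v = 0 + 0"
      using v by simp
    note uniq = factorization[OF v(1) this]
    have "(rng \<Lambda> v, v) = (v, src \<Lambda> v)"
      by (rule trans[OF sym[OF the1_equality[OF uniq]] the1_equality[OF uniq]])
        (simp_all add: v rng_closed src_closed src_rng rng_src cmp_rng cmp_src
        deg_rng deg_src)
    then show ?thesis
      by simp
  qed
  moreover have "deg \<Lambda> v = 0" if "v \<in> mor \<Lambda>" "rng \<Lambda> v = v" for v
    using deg_rng[OF that(1)] that(2) by simp
  ultimately show ?thesis
    unfolding verts_def mor_deg_def by blast
qed

text \<open>\<open>from_deg \<Lambda> v n\<close> is \<open>v\<Lambda>\<^sup>n\<close>, and \<open>between_deg \<Lambda> v n w\<close> is \<open>v\<Lambda>\<^sup>nw\<close>: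
  paths are read from right to left, so the left-hand vertex is the range.\<close>

definition from_vert :: "('a, 'k::finite) graded_cat \<Rightarrow> 'a \<Rightarrow> 'a set" where
  "from_vert \<Lambda> v = {\<kappa> \<in> mor \<Lambda>. rng \<Lambda> \<kappa> = v}"

definition from_deg :: "('a, 'k::finite) graded_cat \<Rightarrow> 'a \<Rightarrow> nat ^ 'k \<Rightarrow> 'a set" where
  "from_deg \<Lambda> v n = from_vert \<Lambda> v \<inter> mor_deg \<Lambda> n"

definition between_deg :: "('a, 'k::finite) graded_cat \<Rightarrow> 'a \<Rightarrow> nat ^ 'k \<Rightarrow> 'a \<Rightarrow> 'a set" where
  "between_deg \<Lambda> v n w = {\<kappa> \<in> from_deg \<Lambda> v n. src \<Lambda> \<kappa> = w}"

definition row_finite :: "('a, 'k::finite) graded_cat \<Rightarrow> bool" where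
  "row_finite \<Lambda> \<longleftrightarrow> (\<forall>v\<in>verts \<Lambda>. \<forall>n. finite (from_deg \<Lambda> v n))"

definition no_sources :: "('a, 'k::finite) graded_cat \<Rightarrow> bool" where
  "no_sources \<Lambda> \<longleftrightarrow> (\<forall>v\<in>verts \<Lambda>. \<forall>n. from_deg \<Lambda> v n \<noteq> {})"

definition cofinal_graph :: "('a, 'k::finite) graded_cat \<Rightarrow> bool" where
  "cofinal_graph \<Lambda> \<longleftrightarrow> (\<forall>v\<in>verts \<Lambda>. \<forall>w\<in>verts \<Lambda>. \<exists>n.
     src \<Lambda> ` from_deg \<Lambda> w n \<subseteq> src \<Lambda> ` from_vert \<Lambda> v)"

text \<open>Finitely supported functions \<open>\<Lambda>\<^sup>0 \<rightarrow> \<nat>\<close> are multisets of vertices,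
  with generators \<open>\<delta>\<^sub>v = {#v#}\<close>.\<close>

definition vert_msets :: "('a, 'k::finite) graded_cat \<Rightarrow> 'a multiset set" where
  "vert_msets \<Lambda> = {f. set_mset f \<subseteq> verts \<Lambda>}"

text \<open>\<open>At \<Lambda> n\<close> is \<open>A\<^sub>n\<^sup>t\<close>.  The inner sum is over a finite set when \<open>\<Lambda>\<close> is row-finite.\<close>

definition At :: "('a, 'k::finite) graded_cat \<Rightarrow> nat ^ 'k \<Rightarrow> 'a multiset \<Rightarrow> 'a multiset" where
  "At \<Lambda> n f = (\<Sum>v\<in>#f. \<Sum>\<kappa>\<in>from_deg \<Lambda> v n. {#src \<Lambda> \<kappa>#})"

definition sim_graph :: "('a, 'k::finite) graded_cat \<Rightarrow> 'a multiset \<Rightarrow> 'a multiset \<Rightarrow> bool" where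
  "sim_graph \<Lambda> f g \<longleftrightarrow> (\<exists>p q. At \<Lambda> p f = At \<Lambda> q g)"

definition approx_graph :: "('a, 'k::finite) graded_cat \<Rightarrow> ('a multiset \<times> 'a multiset) set" where
  "approx_graph \<Lambda> = {(f, g). f \<in> vert_msets \<Lambda> \<and> g \<in> vert_msets \<Lambda> \<and>
     (\<exists>(n::nat) x y. (\<forall>i<n. x i \<in> vert_msets \<Lambda> \<and> y i \<in> vert_msets \<Lambda> \<and> sim_graph \<Lambda> (x i) (y i)) \<and>
        sim_graph \<Lambda> f (\<Sum>i<n. x i) \<and> sim_graph \<Lambda> g (\<Sum>i<n. y i))}"

text \<open>The abelian semigroup \<open>S(\<Lambda>)\<close> as a monoid, which the library writes multiplicatively:
  \<open>\<otimes>\<close> is the addition of classes and \<open>\<one>\<close> is the class of \<open>0\<close>.\<close>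

definition graph_semigroup :: "('a, 'k::finite) graded_cat \<Rightarrow> 'a multiset set monoid" where
  "graph_semigroup \<Lambda> =
    \<lparr>carrier = vert_msets \<Lambda> // approx_graph \<Lambda>,
     monoid.mult = (\<lambda>X Y. \<Union>f\<in>X. \<Union>g\<in>Y. approx_graph \<Lambda> `` {f + g}),
     one = approx_graph \<Lambda> `` {0}\<rparr>"

text \<open>For an abelian semigroup with identity, so \<open>\<one>\<close> plays the role of zero.\<close>

definition infinite_elem :: "('b, 'c) monoid_scheme \<Rightarrow> 'b \<Rightarrow> bool" where
  "infinite_elem S x \<longleftrightarrow> x \<in> carrier S \<and> x \<noteq> \<one>\<^bsub>S\<^esub> \<and>
     (\<exists>y\<in>carrier S. y \<noteq> \<one>\<^bsub>S\<^esub> \<and> x \<otimes>\<^bsub>S\<^esub> y = x)"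

definition stably_finite :: "('b, 'c) monoid_scheme \<Rightarrow> bool" where
  "stably_finite S \<longleftrightarrow> (\<nexists>x. infinite_elem S x)"

end

theory Submission
  imports Defs
begin

text \<open>
  All the maps \<open>A\<^sub>e\<^sub>i\<^sup>t\<close> are one and the same map \<open>A\<close>, which raises the level by one, so
  \<open>A\<^sub>n\<^sup>t\<close> is the power \<open>A\<^bsup>|n|\<^esup>\<close>.  For a vertex \<open>u\<close>, let \<open>\<phi>\<^sub>u(f)\<close> be the number of paths (counted
  by the powers of \<open>A\<close>) from the vertices of \<open>f\<close> to \<open>u\<close>.  It is additive in \<open>f\<close>, and it is invariant
  under \<open>A\<close> as long as \<open>f\<close> lives strictly below the level of \<open>u\<close>; hence \<open>f \<approx> g\<close> implies
  \<open>\<phi>\<^sub>u(f) = \<phi>\<^sub>u(g)\<close> for all \<open>u\<close> of sufficiently high level.  If \<open>x + y \<approx> x\<close>, cancellation in \<open>\<nat>\<close>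
  gives \<open>\<phi>\<^sub>u(y) = 0\<close> for all such \<open>u\<close>.  But if \<open>y \<noteq> 0\<close>, then, as there are no sources, there are \<open>u\<close>
  of arbitrarily high level with \<open>\<phi>\<^sub>u(y) > 0\<close>.
\<close>

section \<open>Additive maps on multisets of vertices\<close>

lemma At_empty [simp]: "At \<Lambda> n {#} = {#}"
  by (simp add: At_def)

lemma At_add: "At \<Lambda> n (f + g) = At \<Lambda> n f + At \<Lambda> n g"
  by (simp add: At_def)

lemma At_single: "At \<Lambda> n {#v#} = (\<Sum>\<kappa>\<in>from_deg \<Lambda> v n. {#src \<Lambda> \<kappa>#})"
  by (simp add: At_def)

lemma At_sum: "At \<Lambda> n (\<Sum>a\<in>S. h a) = (\<Sum>a\<in>S. At \<Lambda> n (h a))"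
  by (induction S rule: infinite_finite_induct) (simp_all add: At_add)

lemma sum_single_mset: "finite S \<Longrightarrow> (\<Sum>a\<in>S. {#h a#}) = image_mset h (mset_set S)"
  by (induction S rule: finite_induct) simp_all

lemma vert_msets_empty [simp]: "{#} \<in> vert_msets \<Lambda>"
  by (simp add: vert_msets_def)

lemma vert_msets_add [simp]: "f + g \<in> vert_msets \<Lambda> \<longleftrightarrow> f \<in> vert_msets \<Lambda> \<and> g \<in> vert_msets \<Lambda>"
  by (simp add: vert_msets_def)

lemma vert_msets_sum: "(\<And>a. a \<in> S \<Longrightarrow> h a \<in> vert_msets \<Lambda>) \<Longrightarrow> (\<Sum>a\<in>S. h a) \<in> vert_msets \<Lambda>"
  by (induction S rule: infinite_finite_induct) simp_all

text \<open>Multisets of vertices are freely generated by the singletons, so identities between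
  additive maps need checking only there.\<close>

lemma additive_eq_on_vert_msets:
  assumes "f \<in> vert_msets \<Lambda>" "F {#} = G {#}"
    and "\<And>f g. F (f + g) = F f + F g" "\<And>f g. G (f + g) = G f + G g"
    and "\<And>v. v \<in> verts \<Lambda> \<Longrightarrow> F {#v#} = G {#v#}"
  shows "F f = G f"
  using assms(1)
proof (induction f)
  case empty
  show ?case by fact
next
  case (add v f)
  then have "F ({#v#} + f) = G ({#v#} + f)"
    using assms(5)[of v] by (simp only: assms(3,4)) (simp add: vert_msets_def)
  then show ?case by simp
qed

text \<open>This puts a representative into its own class. A single summand, equal to
  \<open>f\<close> on both sides, is the witness.\<close>

lemma approx_graph_refl: "f \<in> vert_msets \<Lambda> \<Longrightarrow> (f, f) \<in> approx_graph \<Lambda>"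
proof -
  assume f: "f \<in> vert_msets \<Lambda>"
  have sim: "sim_graph \<Lambda> g g" for g
    unfolding sim_graph_def by blast
  show ?thesis
    unfolding approx_graph_def using f sim
    by (auto intro!: exI[of _ "Suc 0"] exI[of _ "\<lambda>_. f"])
qed

section \<open>Composition of paths by degree\<close>

context k_graph
begin

lemma src_vert: "\<kappa> \<in> mor \<Lambda> \<Longrightarrow> src \<Lambda> \<kappa> \<in> verts \<Lambda>"
  by (simp add: verts_eq_identities rng_src src_src src_closed)

lemma from_deg_0:
  assumes "v \<in> verts \<Lambda>"
  shows "from_deg \<Lambda> v 0 = {v}"
proof -
  have "from_deg \<Lambda> v 0 = {\<kappa> \<in> verts \<Lambda>. rng \<Lambda> \<kappa> = v}"
    by (auto simp: from_deg_def from_vert_def verts_def mor_deg_def)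
  also have "\<dots> = {v}"
    using assms by (auto simp: verts_eq_identities)
  finally show ?thesis .
qed

text \<open>This is the factorization property: its uniqueness part gives injectivity, its existence
  part surjectivity.\<close>

lemma bij_betw_cmp:
  "bij_betw (\<lambda>(\<mu>, \<nu>). cmp \<Lambda> \<mu> \<nu>)
     (SIGMA \<mu>:from_deg \<Lambda> v m. from_deg \<Lambda> (src \<Lambda> \<mu>) n) (from_deg \<Lambda> v (m + n))"
  (is "bij_betw ?c ?A ?B")
proof (rule bij_betw_imageI)
  show "inj_on ?c ?A"
  proof (rule inj_onI, clarify)
    fix \<mu> \<nu> \<mu>' \<nu>'
    assume in_A: "\<mu> \<in> from_deg \<Lambda> v m" "\<nu> \<in> from_deg \<Lambda> (src \<Lambda> \<mu>) n"
      "\<mu>' \<in> from_deg \<Lambda> v m" "\<nu>' \<in> from_deg \<Lambda> (src \<Lambda> \<mu>') n"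
      and eq: "cmp \<Lambda> \<mu> \<nu> = cmp \<Lambda> \<mu>' \<nu>'"
    have "cmp \<Lambda> \<mu> \<nu> \<in> mor \<Lambda>" "deg \<Lambda> (cmp \<Lambda> \<mu> \<nu>) = m + n"
      using in_A by (auto simp: from_deg_def from_vert_def mor_deg_def cmp_closed deg_cmp)
    from factorization[OF this] have "(\<mu>, \<nu>) = (\<mu>', \<nu>')"
      by (rule ex1E) (use in_A eq in \<open>auto simp: from_deg_def from_vert_def mor_deg_def\<close>)
    then show "\<mu> = \<mu>' \<and> \<nu> = \<nu>'"
      by simp
  qed
  show "?c ` ?A = ?B"
  proof (intro equalityI subsetI)
    fix \<kappa> assume "\<kappa> \<in> ?c ` ?A"
    then show "\<kappa> \<in> ?B"
      by (auto simp: from_deg_def from_vert_def mor_deg_def cmp_closed deg_cmp rng_cmp)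
  next
    fix \<kappa> assume \<kappa>: "\<kappa> \<in> ?B"
    then have "\<kappa> \<in> mor \<Lambda>" "deg \<Lambda> \<kappa> = m + n"
      by (auto simp: from_deg_def from_vert_def mor_deg_def)
    from ex1_implies_ex[OF factorization[OF this]] obtain \<mu> \<nu> where
      "\<mu> \<in> mor \<Lambda>" "\<nu> \<in> mor \<Lambda>" "deg \<Lambda> \<mu> = m" "deg \<Lambda> \<nu> = n" "src \<Lambda> \<mu> = rng \<Lambda> \<nu>"
      "\<kappa> = cmp \<Lambda> \<mu> \<nu>"
      by auto
    with \<kappa> have "(\<mu>, \<nu>) \<in> ?A" "\<kappa> = ?c (\<mu>, \<nu>)"
      by (auto simp: from_deg_def from_vert_def mor_deg_def rng_cmp)
    then show "\<kappa> \<in> ?c ` ?A"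
      by blast
  qed
qed

text \<open>Every summand is the source of a morphism, hence a vertex; a sum over an infinite
  \<open>from_deg\<close> is \<open>{#}\<close> by convention.\<close>

lemma At_vert_msets [simp]: "At \<Lambda> n f \<in> vert_msets \<Lambda>"
proof -
  have "At \<Lambda> n {#v#} \<in> vert_msets \<Lambda>" for v
    unfolding At_single
    by (rule vert_msets_sum) (auto simp: vert_msets_def from_deg_def from_vert_def src_vert)
  then have "At \<Lambda> n ({#v#} + g) \<in> vert_msets \<Lambda>" if "At \<Lambda> n g \<in> vert_msets \<Lambda>" for v g
    using that by (simp only: At_add vert_msets_add)
  then show ?thesis
    by (induction f) simp_all
qed

lemma At_0:
  assumes "f \<in> vert_msets \<Lambda>"
  shows "At \<Lambda> 0 f = f"
  using assms
  by (rule additive_eq_on_vert_msets) (simp_all only: At_empty At_add, simp add: At_single from_deg_0 verts_eq_identities)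

end

section \<open>Reduction to powers of one map\<close>

locale levelled_k_graph = k_graph \<Lambda> for \<Lambda> :: "('a, 'k::finite) graded_cat" +
  fixes lev :: "'a \<Rightarrow> int" and i\<^sub>0 :: 'k
  assumes row_fin: "row_finite \<Lambda>"
    and no_src: "no_sources \<Lambda>"
    and lev_src: "\<kappa> \<in> mor_deg \<Lambda> (axis i 1) \<Longrightarrow> lev (src \<Lambda> \<kappa>) = 1 + lev (rng \<Lambda> \<kappa>)"
    and card_between_axis: "\<lbrakk>w \<in> verts \<Lambda>; v \<in> verts \<Lambda>; i \<noteq> j\<rbrakk> \<Longrightarrow>
      card (between_deg \<Lambda> w (axis i 1) v) = card (between_deg \<Lambda> w (axis j 1) v)"
begin

text \<open>The reference direction \<open>i\<^sub>0\<close> stands for all directions, by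
  \<open>At_axis\<close>.\<close>

definition A :: "'a multiset \<Rightarrow> 'a multiset" where
  "A = At \<Lambda> (axis i\<^sub>0 1)"

lemma A_empty [simp]: "A {#} = {#}"
  by (simp add: A_def)

lemma A_add: "A (f + g) = A f + A g"
  by (simp add: A_def At_add)

lemma A_vert_msets [simp]: "A f \<in> vert_msets \<Lambda>"
  by (simp add: A_def)

lemma finite_from_deg: "v \<in> verts \<Lambda> \<Longrightarrow> finite (from_deg \<Lambda> v n)"
  using row_fin by (simp add: row_finite_def)

lemma At_single_eq_image:
  "v \<in> verts \<Lambda> \<Longrightarrow> At \<Lambda> n {#v#} = image_mset (src \<Lambda>) (mset_set (from_deg \<Lambda> v n))"
  by (simp add: At_single sum_single_mset finite_from_deg)

text \<open>On a generator, \<open>bij_betw_cmp\<close> turns the sum over paths of degree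
  \<open>m + n\<close> into a double sum; the source of a composite is that of its second
  factor.\<close>

lemma At_plus:
  assumes "f \<in> vert_msets \<Lambda>"
  shows "At \<Lambda> (m + n) f = At \<Lambda> n (At \<Lambda> m f)"
proof -
  have "At \<Lambda> (m + n) {#v#} = At \<Lambda> n (At \<Lambda> m {#v#})" if v: "v \<in> verts \<Lambda>" for v
  proof -
    have src: "src \<Lambda> (cmp \<Lambda> \<mu> \<nu>) = src \<Lambda> \<nu>"
      if "\<mu> \<in> from_deg \<Lambda> v m" "\<nu> \<in> from_deg \<Lambda> (src \<Lambda> \<mu>) n" for \<mu> \<nu>
      using that by (auto simp: from_deg_def from_vert_def mor_deg_def src_cmp)
    have fin: "finite (from_deg \<Lambda> (src \<Lambda> \<mu>) n)" if "\<mu> \<in> from_deg \<Lambda> v m" for \<mu>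
      using that by (intro finite_from_deg src_vert) (simp add: from_deg_def from_vert_def)
    have "At \<Lambda> n (At \<Lambda> m {#v#}) =
        (\<Sum>\<mu>\<in>from_deg \<Lambda> v m. \<Sum>\<nu>\<in>from_deg \<Lambda> (src \<Lambda> \<mu>) n. {#src \<Lambda> \<nu>#})"
      by (simp add: At_single At_sum)
    also have "\<dots> = (\<Sum>(\<mu>, \<nu>)\<in>(SIGMA \<mu>:from_deg \<Lambda> v m. from_deg \<Lambda> (src \<Lambda> \<mu>) n). {#src \<Lambda> \<nu>#})"
      using fin by (simp add: sum.Sigma finite_from_deg v)
    also have "\<dots> = (\<Sum>z\<in>(SIGMA \<mu>:from_deg \<Lambda> v m. from_deg \<Lambda> (src \<Lambda> \<mu>) n).
        {#src \<Lambda> ((\<lambda>(\<mu>, \<nu>). cmp \<Lambda> \<mu> \<nu>) z)#})"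
      by (rule sum.cong) (auto simp: src)
    also have "\<dots> = At \<Lambda> (m + n) {#v#}"
      unfolding At_single by (rule sum.reindex_bij_betw[OF bij_betw_cmp])
    finally show ?thesis ..
  qed
  then show ?thesis
    by (rule additive_eq_on_vert_msets[OF assms, rotated 3]) (simp_all only: At_empty At_add)
qed

lemma count_At_single:
  assumes "v \<in> verts \<Lambda>"
  shows "count (At \<Lambda> n {#v#}) w = card (between_deg \<Lambda> v n w)"
proof -
  have "between_deg \<Lambda> v n w = src \<Lambda> -` {w} \<inter> from_deg \<Lambda> v n"
    by (auto simp: between_deg_def)
  then show ?thesis
    using assms
    by (simp add: At_single_eq_image count_image_mset finite_from_deg)
qed

text \<open>The multiplicity of \<open>w\<close> in the image of \<open>{#v#}\<close> counts the
  edges between \<open>v\<close> and \<open>w\<close> in direction \<open>i\<close>, which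
  \<open>card_between_axis\<close> makes independent of \<open>i\<close>.\<close>

lemma At_axis:
  assumes "f \<in> vert_msets \<Lambda>"
  shows "At \<Lambda> (axis i 1) f = A f"
proof -
  have "At \<Lambda> (axis i 1) {#v#} = A {#v#}" if v: "v \<in> verts \<Lambda>" for v
  proof (rule multiset_eqI)
    fix w
    show "count (At \<Lambda> (axis i 1) {#v#}) w = count (A {#v#}) w"
    proof (cases "w \<in> verts \<Lambda>")
      case True
      then show ?thesis
        using card_between_axis[OF v True, of i i\<^sub>0] v by (cases "i = i\<^sub>0") (simp_all add: A_def count_At_single)
    next
      case False
      then have "between_deg \<Lambda> v n w = {}" for n
        by (auto simp: between_deg_def from_deg_def from_vert_def src_vert)
      then show ?thesis
        using v by (simp add: A_def count_At_single)
    qed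
  qed
  then show ?thesis
    by (rule additive_eq_on_vert_msets[OF assms, rotated 3]) (simp_all only: At_empty At_add A_empty A_add)
qed

lemma At_eq_funpow:
  assumes "f \<in> vert_msets \<Lambda>"
  shows "At \<Lambda> p f = (A ^^ (\<Sum>i\<in>UNIV. p $ i)) f"
proof (induction "\<Sum>i\<in>UNIV. p $ i" arbitrary: p)
  case 0
  then have "p = 0"
    by (simp add: vec_eq_iff)
  then show ?case
    using assms by (simp add: At_0)
next
  case (Suc N)
  then obtain i where i: "p $ i \<noteq> 0"
    by (metis nat.distinct(1) sum.neutral)
  \<comment> \<open>Remove one unit from a nonzero coordinate of \<open>p\<close>, so that the total
    degree drops by exactly one.\<close>
  define q where "q = (\<chi> j. if j = i then p $ i - 1 else p $ j)"
  have p: "p = q + axis i 1"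
    using i by (auto simp: vec_eq_iff q_def axis_def)
  have "(\<Sum>j\<in>UNIV. p $ j) = Suc (\<Sum>j\<in>UNIV. q $ j)"
    unfolding p by (simp add: sum.distrib axis_def del: One_nat_def)
  with Suc have "At \<Lambda> q f = (A ^^ N) f" and N: "(\<Sum>j\<in>UNIV. q $ j) = N"
    by auto
  then have "At \<Lambda> p f = A ((A ^^ N) f)"
    using assms by (simp add: p At_plus At_axis del: One_nat_def flip: \<open>At \<Lambda> q f = (A ^^ N) f\<close>)
  then show ?case
    by (simp flip: Suc(2))
qed

lemma funpow_A_add: "(A ^^ n) (f + g) = (A ^^ n) f + (A ^^ n) g"
  by (induction n) (simp_all add: A_add)

lemma funpow_A_empty: "(A ^^ n) {#} = {#}"
  by (induction n) simp_all

lemma funpow_A_vert_msets: "f \<in> vert_msets \<Lambda> \<Longrightarrow> (A ^^ n) f \<in> vert_msets \<Lambda>"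
  by (induction n) simp_all

text \<open>As there are no sources, each vertex of \<open>f\<close> contributes at least one edge,
  and nothing cancels in a multiset.\<close>

lemma A_nonempty:
  assumes "f \<in> vert_msets \<Lambda>" "f \<noteq> {#}"
  shows "A f \<noteq> {#}"
proof -
  obtain v g where f: "f = {#v#} + g"
    using assms(2) by (metis add_mset_add_single multiset_cases union_commute)
  then have v: "v \<in> verts \<Lambda>"
    using assms(1) by (simp add: vert_msets_def)
  then have "A {#v#} \<noteq> {#}"
    using no_src by (simp add: A_def At_single_eq_image mset_set_empty_iff finite_from_deg no_sources_def)
  then show ?thesis
    unfolding f A_add by simp
qed

lemma funpow_A_nonempty: "f \<in> vert_msets \<Lambda> \<Longrightarrow> f \<noteq> {#} \<Longrightarrow> (A ^^ n) f \<noteq> {#}"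
  by (induction n) (simp_all add: A_nonempty funpow_A_vert_msets)

section \<open>Levels and path counts\<close>

lemma lev_A_single: "v \<in> verts \<Lambda> \<Longrightarrow> w \<in># A {#v#} \<Longrightarrow> lev w = lev v + 1"
  by (auto simp: A_def At_single_eq_image finite_from_deg)
    (auto simp: from_deg_def from_vert_def lev_src)

lemma lev_A:
  assumes "f \<in> vert_msets \<Lambda>" "w \<in># A f"
  obtains v where "v \<in># f" "lev w = lev v + 1"
proof -
  have "\<exists>v. v \<in># f \<and> lev w = lev v + 1"
    using assms
  proof (induction f)
    case (add v f)
    then show ?case
      using lev_A_single[of v w]
      using A_add[of "{#v#}" f] by (auto simp: vert_msets_def)
  qed simp
  with that show ?thesis by blast
qed

lemma lev_funpow_A_single: "v \<in> verts \<Lambda> \<Longrightarrow> w \<in># (A ^^ n) {#v#} \<Longrightarrow> lev w = lev v + int n"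
proof (induction n arbitrary: w)
  case (Suc n)
  have "(A ^^ n) {#v#} \<in> vert_msets \<Lambda>"
    using Suc.prems(1) by (intro funpow_A_vert_msets) (simp add: vert_msets_def)
  with Suc show ?case
    by (auto elim!: lev_A)
qed simp

text \<open>For \<open>lev v > lev u\<close> the exponent is truncated to \<open>0\<close>, but the summand is then \<open>0\<close> anyway.\<close>

definition paths_to :: "'a \<Rightarrow> 'a multiset \<Rightarrow> nat" where
  "paths_to u f = (\<Sum>v\<in>#f. count ((A ^^ nat (lev u - lev v)) {#v#}) u)"

lemma paths_to_add: "paths_to u (f + g) = paths_to u f + paths_to u g"
  by (simp add: paths_to_def)

lemma paths_to_sum: "paths_to u (\<Sum>a\<in>S. h a) = (\<Sum>a\<in>S. paths_to u (h a))"
  by (induction S rule: infinite_finite_induct) (simp_all add: paths_to_add, simp_all add: paths_to_def)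

text \<open>With a common level the exponent is the same for all summands, so additivity of the
  power collects them.\<close>

lemma paths_to_same_level:
  assumes "\<And>v. v \<in># f \<Longrightarrow> lev v = l"
  shows "paths_to u f = count ((A ^^ nat (lev u - l)) f) u"
  using assms
proof (induction f)
  case (add v f)
  then show ?case
    using funpow_A_add[of _ "{#v#}" f] by (simp add: paths_to_def)
qed (simp add: paths_to_def funpow_A_empty)

text \<open>One application of \<open>A\<close> raises the level by one and so uses up one factor of
  the power in \<open>paths_to\<close>.\<close>

lemma paths_to_A:
  assumes "f \<in> vert_msets \<Lambda>" "\<And>v. v \<in># f \<Longrightarrow> lev v < lev u"
  shows "paths_to u (A f) = paths_to u f"
  using assms
proof (induction f)
  case (add v f)
  then have v: "v \<in> verts \<Lambda>" "lev v < lev u"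
    by (auto simp: vert_msets_def)
  have "paths_to u (A {#v#}) = count ((A ^^ nat (lev u - (lev v + 1))) (A {#v#})) u"
    using lev_A_single[OF v(1)] by (rule paths_to_same_level)
  also have "\<dots> = count ((A ^^ Suc (nat (lev u - (lev v + 1)))) {#v#}) u"
    by (simp add: funpow_swap1)
  \<comment> \<open>Strictness of \<open>lev v < lev u\<close> matters: at equal levels the left
    side is 1 and the right side 0.\<close>
  also have "Suc (nat (lev u - (lev v + 1))) = nat (lev u - lev v)"
    using v(2) by simp
  finally have "paths_to u (A {#v#}) = paths_to u {#v#}"
    by (simp add: paths_to_def)
  moreover have "paths_to u (A f) = paths_to u f"
    using add by (auto simp: vert_msets_def)
  ultimately show ?case
    using A_add[of "{#v#}" f] paths_to_add[of u "{#v#}" f] by (simp add: paths_to_add)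
qed simp

section \<open>Invariance at all sufficiently high levels\<close>

lemma eventually_lev_less:
  "eventually (\<lambda>u. \<forall>v\<in>#f. lev v < lev u) (filtercomap lev at_top)"
  by (intro eventually_ball_finite ballI eventually_filtercomapI[where P = "\<lambda>l. _ < l"])
    (simp_all add: eventually_gt_at_top)

text \<open>\<open>filtercomap lev at_top\<close> expresses "for all \<open>u\<close> of
  sufficiently high level". Each of the finitely many applications of \<open>A\<close> only asks
  \<open>u\<close> to lie above a finite multiset.\<close>

lemma eventually_paths_to_At:
  assumes "f \<in> vert_msets \<Lambda>"
  shows "eventually (\<lambda>u. paths_to u (At \<Lambda> p f) = paths_to u f) (filtercomap lev at_top)"
proof -
  have "eventually (\<lambda>u. paths_to u ((A ^^ n) f) = paths_to u f) (filtercomap lev at_top)" for n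
  proof (induction n)
    case (Suc n)
    with eventually_lev_less[of "(A ^^ n) f"] show ?case
      by eventually_elim (simp add: paths_to_A funpow_A_vert_msets assms)
  qed simp
  then show ?thesis
    by (simp add: At_eq_funpow assms)
qed

lemma eventually_paths_to_sim:
  assumes "f \<in> vert_msets \<Lambda>" "g \<in> vert_msets \<Lambda>" "sim_graph \<Lambda> f g"
  shows "eventually (\<lambda>u. paths_to u f = paths_to u g) (filtercomap lev at_top)"
proof -
  obtain p q where "At \<Lambda> p f = At \<Lambda> q g"
    using assms(3) by (auto simp: sim_graph_def)
  with eventually_paths_to_At[OF assms(1), of p] eventually_paths_to_At[OF assms(2), of q]
  show ?thesis
    by (auto elim: eventually_elim2)
qed

text \<open>The decomposition has finitely many summands, so their level bounds have a common upper
  bound; additivity then adds up the equalities.\<close>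

lemma eventually_paths_to_approx:
  assumes "(f, g) \<in> approx_graph \<Lambda>"
  shows "eventually (\<lambda>u. paths_to u f = paths_to u g) (filtercomap lev at_top)"
proof -
  obtain n :: nat and x y where fg: "f \<in> vert_msets \<Lambda>" "g \<in> vert_msets \<Lambda>"
    and xy: "\<forall>i<n. x i \<in> vert_msets \<Lambda> \<and> y i \<in> vert_msets \<Lambda> \<and> sim_graph \<Lambda> (x i) (y i)"
    and sim: "sim_graph \<Lambda> f (\<Sum>i<n. x i)" "sim_graph \<Lambda> g (\<Sum>i<n. y i)"
    using assms unfolding approx_graph_def by blast
  have "eventually (\<lambda>u. \<forall>i\<in>{..<n}. paths_to u (x i) = paths_to u (y i)) (filtercomap lev at_top)"
    using xy by (intro eventually_ball_finite) (auto intro: eventually_paths_to_sim)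
  moreover have "eventually (\<lambda>u. paths_to u f = paths_to u (\<Sum>i<n. x i)) (filtercomap lev at_top)"
    using fg xy sim by (intro eventually_paths_to_sim vert_msets_sum) auto
  moreover have "eventually (\<lambda>u. paths_to u g = paths_to u (\<Sum>i<n. y i)) (filtercomap lev at_top)"
    using fg xy sim by (intro eventually_paths_to_sim vert_msets_sum) auto
  ultimately show ?thesis
    by eventually_elim (simp add: paths_to_sum)
qed

section \<open>Positivity and cancellation\<close>

lemma paths_to_pos_above:
  assumes "f \<in> vert_msets \<Lambda>" "f \<noteq> {#}"
  obtains u where "lev u \<ge> B" "paths_to u f > 0"
proof -
  obtain v g where f: "f = {#v#} + g"
    using assms(2) by (metis add_mset_add_single multiset_cases union_commute)
  then have v: "v \<in> verts \<Lambda>"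
    using assms(1) by (simp add: vert_msets_def)
  \<comment> \<open>Enough steps to climb from \<open>v\<close> to level \<open>B\<close>; the
    truncation to 0 covers a \<open>v\<close> already at or above \<open>B\<close>.\<close>
  define N where "N = nat (B - lev v)"
  have "(A ^^ N) {#v#} \<noteq> {#}"
    using v by (intro funpow_A_nonempty) (simp_all add: vert_msets_def)
  then obtain u where u: "u \<in># (A ^^ N) {#v#}"
    by blast
  then have lev: "lev u = lev v + int N"
    by (rule lev_funpow_A_single[OF v])
  then have "paths_to u {#v#} > 0"
    using u by (simp add: paths_to_def)
  moreover have "lev u \<ge> B"
    by (simp add: lev N_def)
  ultimately show ?thesis
    using that paths_to_add[of u "{#v#}" g] by (simp add: f)
qed

text \<open>Cancelling \<open>paths_to u f\<close> in the natural numbers leaves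
  \<open>paths_to u g = 0\<close> at all high levels, against
  \<open>paths_to_pos_above\<close>.\<close>

lemma approx_add_left_imp_empty:
  assumes "(f, f + g) \<in> approx_graph \<Lambda>"
  shows "g = {#}"
proof (rule ccontr)
  assume g: "g \<noteq> {#}"
  have "g \<in> vert_msets \<Lambda>"
    using assms by (simp add: approx_graph_def)
  moreover obtain B where "\<And>u. lev u \<ge> B \<Longrightarrow> paths_to u f = paths_to u (f + g)"
    using eventually_paths_to_approx[OF assms]
    by (auto simp: eventually_filtercomap_at_top_linorder)
  then have "\<And>u. lev u \<ge> B \<Longrightarrow> paths_to u g = 0"
    by (simp add: paths_to_add)
  ultimately show False
    using g by (metis paths_to_pos_above less_irrefl)
qed

end

theorem proposition6p5:
  fixes \<Lambda> :: "('a, 'k::finite) graded_cat"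
    and lev :: "'a \<Rightarrow> int"
  assumes "k_graph \<Lambda>"
    and "row_finite \<Lambda>"
    and "cofinal_graph \<Lambda>"
    and "no_sources \<Lambda>"
    and "\<forall>i::'k. \<forall>\<kappa>\<in>mor_deg \<Lambda> (axis i 1). lev (src \<Lambda> \<kappa>) = 1 + lev (rng \<Lambda> \<kappa>)"
    and "\<forall>w\<in>verts \<Lambda>. \<forall>v\<in>verts \<Lambda>. \<forall>i j::'k. i \<noteq> j \<longrightarrow>
           card (between_deg \<Lambda> w (axis i 1) v) = card (between_deg \<Lambda> w (axis j 1) v)"
  shows "stably_finite (graph_semigroup \<Lambda>)"
proof -
  interpret k_graph \<Lambda> by fact
  \<comment> \<open>Types are nonempty, so \<open>undefined\<close> is some index in
    \<open>'k\<close>; any choice of reference direction serves.\<close>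
  interpret levelled_k_graph \<Lambda> lev undefined
    by unfold_locales (use assms in blast)+
  show ?thesis
    unfolding stably_finite_def infinite_elem_def
  proof clarify
    fix X Y
    assume "X \<in> carrier (graph_semigroup \<Lambda>)" "Y \<in> carrier (graph_semigroup \<Lambda>)"
      and Y: "Y \<noteq> \<one>\<^bsub>graph_semigroup \<Lambda>\<^esub>" and XY: "X \<otimes>\<^bsub>graph_semigroup \<Lambda>\<^esub> Y = X"
    then obtain f g where f: "f \<in> vert_msets \<Lambda>" "X = approx_graph \<Lambda> `` {f}"
      and g: "g \<in> vert_msets \<Lambda>" "Y = approx_graph \<Lambda> `` {g}"
      by (auto simp: graph_semigroup_def elim!: quotientE)
    \<comment> \<open>The product is the union of the classes of sums over all pairs of
      representatives, so the pair \<open>f\<close>, \<open>g\<close> already places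
      \<open>f + g\<close> in it.\<close>
    have "f + g \<in> X \<otimes>\<^bsub>graph_semigroup \<Lambda>\<^esub> Y"
      using f g by (auto simp: graph_semigroup_def intro!: bexI approx_graph_refl)
    then have "(f, f + g) \<in> approx_graph \<Lambda>"
      using XY f(2) by simp
    then have "g = {#}"
      by (rule approx_add_left_imp_empty)
    with Y g(2) show False
      by (simp add: graph_semigroup_def)
  qed
qed

end
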